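(* Let $G=(V,E,\omega,\mu)$ be a graph with $\mu_{\min}>0$, $\mu_{\max}<\infty$, $\omega_{\min}>0$ and $D_\mu<\infty$. Assume $G$ satisfies $CDE(n,0)$ for some $n\in(0,\infty)$ and that there exist constants $c_3>0$ and $m>0$ such that $\mathcal V(x,R)\ge c_3R^m$ for all $x\in V$ and all $R>0$. Let $1\le a,b,r\le\infty$ satisfy $$1+\frac1b=\frac1a+\frac1r$$ (with $1/\infty=0$). Let $C_4=C_4(n,\mu_{\max},\omega_{\min},c_3,r,m)>0$ be a constant for which $\|P(t,x,\cdot)\|_{\ell^r(V)}\le C_4t^{-\frac m2(1-\frac1r)}$ for all $x\in V$ and $t>0$ (such a constant, depending only on the listed quantities, exists under these hypotheses). Then for every $g\in\ell^a(V)$ and all $t>0$, $$\left\|\sum_{y\in V}P(t,\cdot,y)g(y)\mu(y)\right\|_{\ell^b(V)}\le\hat C_4\,\|g\|_{\ell^a(V)}\,t^{-\frac m2\left(1-\frac1r\right)},$$ where $\hat C_4=C_4$ if $b\in(1,+\infty]$ and $\hat C_4=1$ if $b=1$.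
   Context: Graphs: $G=(V,E,\omega,\mu)$ is an infinite, locally finite, connected graph without loops or multiple edges; $\omega:V\times V\to[0,\infty)$ is symmetric with $\omega_{xy}>0$ iff $x\sim y$ (i.e. $xy\in E$); $\mu:V\to(0,\infty)$. Notation: $\mu_{\min}=\inf_V\mu$, $\mu_{\max}=\sup_V\mu$, $\omega_{\min}=\inf_{xy\in E}\omega_{xy}$, $D_\mu=\sup_{x\in V}\frac{1}{\mu(x)}\sum_{y\sim x}\omega_{xy}$. $d(x,y)$ is the combinatorial graph distance (minimal number of edges in a path), $B(x,R)=\{y\in V:d(x,y)\le R\}$, and $\mathcal V(x,R)=\sum_{y\in B(x,R)}\mu(y)$. $\ell^r(V)=\ell^r(V,\mu)$ has norm $\|f\|_{\ell^r(V)}=(\sum_{x}\mu(x)|f(x)|^r)^{1/r}$ for $1\le r<\infty$ and $\|f\|_{\ell^\infty(V)}=\sup_V|f|$. Laplacian: $\Delta f(x)=\frac1{\mu(x)}\sum_{y\sim x}\omega_{xy}(f(y)-f(x))$. Gradient forms: $\Gamma(f,g)(x)=\frac1{2\mu(x)}\sum_{y\sim x}\omega_{xy}(f(y)-f(x))(g(y)-g(x))$, $\Gamma_2(f,g)=\frac12(\Delta\Gamma(f,g)-\Gamma(f,\Delta g)-\Gamma(\Delta f,g))$, $\Gamma(f)=\Gamma(f,f)$, $\Gamma_2(f)=\Gamma_2(f,f)$. $CDE(n,K)$ ($n>0$, $K\in\mathbb R$): for every $x\in V$ and every $f:V\to(0,\infty)$ with $\Delta f(x)<0$, $\Gamma_2(f)(x)-\Gamma\left(f,\frac{\Gamma(f)}{f}\right)(x)\ge\frac1n(\Delta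 f(x))^2+K\Gamma(f)(x)$. Heat kernel: $P(t,x,y)$ is the smallest nonnegative function satisfying $\partial_tP(t,x,y)=\Delta P(t,x,y)$ (with $\Delta$ acting in either $x$ or $y$) for $t>0$, $x,y\in V$, and $P(0,x,y)=\frac1{\mu(y)}$ if $x=y$, $0$ if $x\ne y$. *)

theory Defs
  imports "HOL-Analysis.Analysis"
begin

text \<open>
  A weighted graph is given by an edge weight \<open>\<omega>\<close> and a vertex measure \<open>\<mu>\<close>. Its vertex set is the
  whole type \<open>'v\<close>, and its edges are the pairs of positive weight.
\<close>

definition adj :: "('v \<Rightarrow> 'v \<Rightarrow> real) \<Rightarrow> 'v \<Rightarrow> 'v \<Rightarrow> bool" where
  "adj \<omega> x y \<longleftrightarrow> 0 < \<omega> x y"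

definition weighted_graph :: "('v \<Rightarrow> 'v \<Rightarrow> real) \<Rightarrow> ('v \<Rightarrow> real) \<Rightarrow> bool" where
  "weighted_graph \<omega> \<mu> \<longleftrightarrow>
     infinite (UNIV :: 'v set) \<and>
     (\<forall>x y. 0 \<le> \<omega> x y) \<and>
     (\<forall>x y. \<omega> x y = \<omega> y x) \<and>
     (\<forall>x. \<not> adj \<omega> x x) \<and>
     (\<forall>x. finite {y. adj \<omega> x y}) \<and>
     (\<forall>x y. (adj \<omega>)\<^sup>*\<^sup>* x y) \<and>
     (\<forall>x. 0 < \<mu> x)"

text \<open>Extrema are taken in the extended reals, so that an unbounded supremum is \<open>\<infinity>\<close>.\<close>

definition mu_min :: "('v \<Rightarrow> real) \<Rightarrow> ereal" where
  "mu_min \<mu> = (INF x. ereal (\<mu> x))"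

definition mu_max :: "('v \<Rightarrow> real) \<Rightarrow> ereal" where
  "mu_max \<mu> = (SUP x. ereal (\<mu> x))"

definition omega_min :: "('v \<Rightarrow> 'v \<Rightarrow> real) \<Rightarrow> ereal" where
  "omega_min \<omega> = (INF (x, y) \<in> {(x, y). adj \<omega> x y}. ereal (\<omega> x y))"

definition D_mu :: "('v \<Rightarrow> 'v \<Rightarrow> real) \<Rightarrow> ('v \<Rightarrow> real) \<Rightarrow> ereal" where
  "D_mu \<omega> \<mu> = (SUP x. ereal (1 / \<mu> x * (\<Sum>y | adj \<omega> x y. \<omega> x y)))"

definition gdist :: "('v \<Rightarrow> 'v \<Rightarrow> real) \<Rightarrow> 'v \<Rightarrow> 'v \<Rightarrow> nat" where
  "gdist \<omega> x y = (LEAST k. (adj \<omega> ^^ k) x y)"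

definition gball :: "('v \<Rightarrow> 'v \<Rightarrow> real) \<Rightarrow> 'v \<Rightarrow> real \<Rightarrow> 'v set" where
  "gball \<omega> x R = {y. real (gdist \<omega> x y) \<le> R}"

text \<open>Balls are finite in a connected locally finite graph, so a plain finite sum suffices.\<close>

definition volume :: "('v \<Rightarrow> 'v \<Rightarrow> real) \<Rightarrow> ('v \<Rightarrow> real) \<Rightarrow> 'v \<Rightarrow> real \<Rightarrow> real" where
  "volume \<omega> \<mu> x R = (\<Sum>y \<in> gball \<omega> x R. \<mu> y)"

definition laplacian ::
  "('v \<Rightarrow> 'v \<Rightarrow> real) \<Rightarrow> ('v \<Rightarrow> real) \<Rightarrow> ('v \<Rightarrow> real) \<Rightarrow> 'v \<Rightarrow> real" where
  "laplacian \<omega> \<mu> f x = 1 / \<mu> x * (\<Sum>y | adj \<omega> x y. \<omega> x y * (f y - f x))"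

definition Gam ::
  "('v \<Rightarrow> 'v \<Rightarrow> real) \<Rightarrow> ('v \<Rightarrow> real) \<Rightarrow> ('v \<Rightarrow> real) \<Rightarrow> ('v \<Rightarrow> real) \<Rightarrow> 'v \<Rightarrow> real" where
  "Gam \<omega> \<mu> f g x = 1 / (2 * \<mu> x) * (\<Sum>y | adj \<omega> x y. \<omega> x y * (f y - f x) * (g y - g x))"

definition Gam2 ::
  "('v \<Rightarrow> 'v \<Rightarrow> real) \<Rightarrow> ('v \<Rightarrow> real) \<Rightarrow> ('v \<Rightarrow> real) \<Rightarrow> ('v \<Rightarrow> real) \<Rightarrow> 'v \<Rightarrow> real" where
  "Gam2 \<omega> \<mu> f g x =
     1 / 2 * (laplacian \<omega> \<mu> (Gam \<omega> \<mu> f g) x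
              - Gam \<omega> \<mu> f (laplacian \<omega> \<mu> g) x
              - Gam \<omega> \<mu> (laplacian \<omega> \<mu> f) g x)"

definition CDE :: "('v \<Rightarrow> 'v \<Rightarrow> real) \<Rightarrow> ('v \<Rightarrow> real) \<Rightarrow> real \<Rightarrow> real \<Rightarrow> bool" where
  "CDE \<omega> \<mu> n K \<longleftrightarrow>
     (\<forall>x f. (\<forall>z. 0 < f z) \<and> laplacian \<omega> \<mu> f x < 0 \<longrightarrow>
        Gam2 \<omega> \<mu> f f x - Gam \<omega> \<mu> f (\<lambda>z. Gam \<omega> \<mu> f f z / f z) x
          \<ge> 1 / n * (laplacian \<omega> \<mu> f x)\<^sup>2 + K * Gam \<omega> \<mu> f f x)"

text \<open>
  The right-continuity at time 0 ties the equation on \<open>t > 0\<close> to the initial value: without it the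
  function that is 0 for all \<open>t > 0\<close> would be the smallest solution. Values at negative times are
  irrelevant throughout.
\<close>

definition heat_fundamental_solution ::
  "('v \<Rightarrow> 'v \<Rightarrow> real) \<Rightarrow> ('v \<Rightarrow> real) \<Rightarrow> (real \<Rightarrow> 'v \<Rightarrow> 'v \<Rightarrow> real) \<Rightarrow> bool" where
  "heat_fundamental_solution \<omega> \<mu> P \<longleftrightarrow>
     (\<forall>t\<ge>0. \<forall>x y. 0 \<le> P t x y) \<and>
     (\<forall>t>0. \<forall>x y.
        ((\<lambda>s. P s x y) has_real_derivative laplacian \<omega> \<mu> (\<lambda>z. P t z y) x) (at t) \<and>
        ((\<lambda>s. P s x y) has_real_derivative laplacian \<omega> \<mu> (\<lambda>z. P t x z) y) (at t)) \<and>
     (\<forall>x y. P 0 x y = (if x = y then 1 / \<mu> y else 0)) \<and>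
     (\<forall>x y. ((\<lambda>s. P s x y) \<longlongrightarrow> P 0 x y) (at_right 0))"

definition is_heat_kernel ::
  "('v \<Rightarrow> 'v \<Rightarrow> real) \<Rightarrow> ('v \<Rightarrow> real) \<Rightarrow> (real \<Rightarrow> 'v \<Rightarrow> 'v \<Rightarrow> real) \<Rightarrow> bool" where
  "is_heat_kernel \<omega> \<mu> P \<longleftrightarrow>
     heat_fundamental_solution \<omega> \<mu> P \<and>
     (\<forall>Q. heat_fundamental_solution \<omega> \<mu> Q \<longrightarrow> (\<forall>t\<ge>0. \<forall>x y. P t x y \<le> Q t x y))"

text \<open>
  The exponent ranges over \<open>1 \<le> p \<le> \<infinity>\<close>. The value of \<open>ell_norm\<close> is meaningful only for members
  of \<open>ell_space\<close>, so bounds on it are always to be stated together with membership.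
\<close>

definition ell_space :: "('v \<Rightarrow> real) \<Rightarrow> ennreal \<Rightarrow> ('v \<Rightarrow> real) set" where
  "ell_space \<mu> p =
     (if p = \<infinity> then {f. bounded (range f)}
      else {f. (\<lambda>x. \<mu> x * \<bar>f x\<bar> powr enn2real p) summable_on UNIV})"

definition ell_norm :: "('v \<Rightarrow> real) \<Rightarrow> ennreal \<Rightarrow> ('v \<Rightarrow> real) \<Rightarrow> real" where
  "ell_norm \<mu> p f =
     (if p = \<infinity> then (SUP x. \<bar>f x\<bar>)
      else (\<Sum>\<^sub>\<infinity>x. \<mu> x * \<bar>f x\<bar> powr enn2real p) powr (1 / enn2real p))"

end

theory Submission
  imports Defs
begin

text \<open>
  By minimality \<open>P\<close> lies below its transpose, hence is symmetric, and the estimate is Young's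
  inequality for a symmetric kernel: after normalising, the weighted AM-GM inequality bounds \<open>p * h\<close>
  by a combination of \<open>p\<^sup>r * h\<^sup>a\<close>, \<open>p\<^sup>r\<close> and \<open>h\<^sup>a\<close>, and summing over the first variable
  uses the symmetry. If \<open>b = 1\<close> then \<open>a = r = 1\<close>, and the sharp constant \<open>1\<close> comes from the fact
  that the heat kernel has total mass at most \<open>1\<close>.
\<close>

section \<open>Weighted AM-GM and the pointwise form of Young's inequality\<close>

text \<open>With \<open>s\<close> the weighted mean of the logarithms, the tangent of
  \<open>exp\<close> at \<open>s\<close> lies below \<open>exp\<close>. Averaging the three tangent
  inequalities with the given weights cancels the linear terms and leaves \<open>exp s\<close>, the
  weighted geometric mean.\<close>

lemma weighted_am_gm3:
  fixes x y z a b c :: real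
  assumes pos: "0 < x" "0 < y" "0 < z" and wts: "0 \<le> a" "0 \<le> b" "0 \<le> c" "a + b + c = 1"
  shows "x powr a * y powr b * z powr c \<le> a * x + b * y + c * z"
proof -
  have tangent: "1 + (u - s) \<le> exp (u - s)" for u s :: real
    using exp_ge_add_one_self[of "u - s"] by simp
  define s where "s = a * ln x + b * ln y + c * ln z"
  have E: "exp s * (1 + (ln u - s)) \<le> u" if "0 < u" for u
  proof -
    have "exp s * (1 + (ln u - s)) \<le> exp s * exp (ln u - s)"
      by (intro mult_left_mono tangent) auto
    also have "\<dots> = u" using that by (simp add: exp_diff)
    finally show ?thesis .
  qed
  have "exp s = exp s * (a * (1 + (ln x - s)) + b * (1 + (ln y - s)) + c * (1 + (ln z - s)))"
  proof -
    have "a * (1 + (ln x - s)) + b * (1 + (ln y - s)) + c * (1 + (ln z - s)) =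
      (a + b + c) * (1 - s) + s"
      unfolding s_def by (simp add: algebra_simps)
    then show ?thesis using wts(4) by simp
  qed
  also have "\<dots> = a * (exp s * (1 + (ln x - s))) + b * (exp s * (1 + (ln y - s)))
      + c * (exp s * (1 + (ln z - s)))"
    by (simp add: algebra_simps)
  also have "\<dots> \<le> a * x + b * y + c * z"
    using wts pos by (intro add_mono mult_left_mono E) auto
  finally show ?thesis
    using pos by (simp add: s_def exp_add powr_def mult.commute)
qed

text \<open>The weights \<beta>, 1 - 1/\<alpha> and 1 - 1/\<rho> sum to 1 by the exponent relation,
  and in the corresponding geometric mean both \<open>p\<close> and \<open>h\<close> occur with
  exponent 1. The factor \<open>S powr \<beta>\<close> undoes the division by \<open>S\<close>, so
  \<open>S\<close> is a free scale to be chosen after summation.\<close>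

lemma young_pointwise:
  fixes p h S \<alpha> \<beta> \<rho> :: real
  assumes "0 \<le> p" "0 \<le> h" "0 < S" and exps: "1 \<le> \<alpha>" "1 \<le> \<rho>" "0 \<le> \<beta>" "1 / \<alpha> + 1 / \<rho> = 1 + \<beta>"
  shows "p * h \<le> S powr \<beta> *
    (\<beta> * (p powr \<rho> * h powr \<alpha> / S) + (1 - 1 / \<alpha>) * p powr \<rho> + (1 - 1 / \<rho>) * h powr \<alpha>)"
proof (cases "p = 0 \<or> h = 0")
  \<comment> \<open>AM-GM takes logarithms, so vanishing factors are separated; here the left side
    is 0.\<close>
  case True
  then show ?thesis using assms by auto
next
  case False
  then have pos: "0 < p" "0 < h" using assms by auto
  let ?X = "p powr \<rho> * h powr \<alpha> / S"
  have b: "\<beta> = 1 / \<alpha> + 1 / \<rho> - 1" using exps by simp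
  have "S powr \<beta> * (?X powr \<beta> * (p powr \<rho>) powr (1 - 1 / \<alpha>) * (h powr \<alpha>) powr (1 - 1 / \<rho>))
     = p powr (\<rho> * \<beta> + \<rho> * (1 - 1 / \<alpha>)) * h powr (\<alpha> * \<beta> + \<alpha> * (1 - 1 / \<rho>))"
    using pos assms(3) by (simp add: powr_divide powr_mult powr_powr powr_add)
  also have "\<rho> * \<beta> + \<rho> * (1 - 1 / \<alpha>) = 1" using exps unfolding b by (simp add: field_simps)
  also have "\<alpha> * \<beta> + \<alpha> * (1 - 1 / \<rho>) = 1" using exps unfolding b by (simp add: field_simps)
  finally have "p * h = S powr \<beta> *
      (?X powr \<beta> * (p powr \<rho>) powr (1 - 1 / \<alpha>) * (h powr \<alpha>) powr (1 - 1 / \<rho>))"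
    using pos by simp
  also have "\<dots> \<le> S powr \<beta> * (\<beta> * ?X + (1 - 1 / \<alpha>) * p powr \<rho> + (1 - 1 / \<rho>) * h powr \<alpha>)"
    using pos assms(3) exps by (intro mult_left_mono weighted_am_gm3) auto
  finally show ?thesis .
qed

text \<open>Sum the pointwise bound with \<open>S\<close> equal to the mixed sum itself. The bracket
  is then at most the sum of the three weights, which is 1, and only \<open>S powr \<beta>\<close>
  survives.\<close>

lemma interpolated_hoelder:
  fixes \<mu> p h :: "'v \<Rightarrow> real" and \<alpha> \<beta> \<rho> :: real
  assumes mu: "\<And>y. 0 \<le> \<mu> y" and p: "\<And>y. 0 \<le> p y" and h: "\<And>y. 0 \<le> h y"
    and exps: "1 \<le> \<alpha>" "1 \<le> \<rho>" "0 \<le> \<beta>" "1 / \<alpha> + 1 / \<rho> = 1 + \<beta>"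
    and p_sum: "(\<lambda>y. \<mu> y * p y powr \<rho>) summable_on UNIV" "(\<Sum>\<^sub>\<infinity>y. \<mu> y * p y powr \<rho>) \<le> 1"
    and h_sum: "(\<lambda>y. \<mu> y * h y powr \<alpha>) summable_on UNIV" "(\<Sum>\<^sub>\<infinity>y. \<mu> y * h y powr \<alpha>) \<le> 1"
    and S_sum: "(\<lambda>y. \<mu> y * (p y powr \<rho> * h y powr \<alpha>)) summable_on UNIV"
  shows "(\<lambda>y. \<mu> y * (p y * h y)) summable_on UNIV"
    and "(\<Sum>\<^sub>\<infinity>y. \<mu> y * (p y * h y)) \<le> (\<Sum>\<^sub>\<infinity>y. \<mu> y * (p y powr \<rho> * h y powr \<alpha>)) powr \<beta>"
proof -
  define S where "S = (\<Sum>\<^sub>\<infinity>y. \<mu> y * (p y powr \<rho> * h y powr \<alpha>))"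
  have "0 \<le> S" unfolding S_def by (intro infsum_nonneg) (simp add: mu)
  have "(\<lambda>y. \<mu> y * (p y * h y)) summable_on UNIV \<and> (\<Sum>\<^sub>\<infinity>y. \<mu> y * (p y * h y)) \<le> S powr \<beta>"
  proof (cases "S = 0")
    \<comment> \<open>Division by \<open>S\<close> is impossible here, and
      \<open>0 powr \<beta>\<close> is 0 even for \<beta> = 0, so the sum must be shown to vanish:
      every mixed term is 0, and with it every term \<open>\<mu> y * (p y * h y)\<close>.\<close>
    case True
    have "\<mu> y * (p y powr \<rho> * h y powr \<alpha>) = 0" for y
      by (rule nonneg_infsum_le_0D[OF _ S_sum]) (use True mu in \<open>auto simp: S_def\<close>)
    then have "(\<lambda>y. \<mu> y * (p y * h y)) = (\<lambda>_. 0)" by auto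
    then show ?thesis by simp
  next
    case False
    with \<open>0 \<le> S\<close> have S: "0 < S" by simp
    define G where "G = (\<lambda>y. S powr \<beta> * (\<beta> / S * (\<mu> y * (p y powr \<rho> * h y powr \<alpha>))
       + (1 - 1 / \<alpha>) * (\<mu> y * p y powr \<rho>) + (1 - 1 / \<rho>) * (\<mu> y * h y powr \<alpha>)))"
    have hs: "(G has_sum S powr \<beta> * (\<beta> / S * S + (1 - 1 / \<alpha>) * (\<Sum>\<^sub>\<infinity>y. \<mu> y * p y powr \<rho>)
       + (1 - 1 / \<rho>) * (\<Sum>\<^sub>\<infinity>y. \<mu> y * h y powr \<alpha>))) UNIV"
      unfolding G_def S_def
      by (intro has_sum_cmult_right has_sum_add has_sum_infsum p_sum h_sum S_sum)
    have le: "\<mu> y * (p y * h y) \<le> G y" for y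
      using mult_left_mono[OF young_pointwise[OF p h S exps] mu, of y y y]
      by (simp add: G_def algebra_simps)
    have sm: "(\<lambda>y. \<mu> y * (p y * h y)) summable_on UNIV"
      by (rule summable_on_comparison_test[OF has_sum_imp_summable[OF hs] le]) (simp add: mu p h)
    have "(\<Sum>\<^sub>\<infinity>y. \<mu> y * (p y * h y)) \<le> infsum G UNIV"
      by (intro infsum_mono sm has_sum_imp_summable[OF hs] le)
    also have "\<dots> = S powr \<beta> * (\<beta> / S * S + (1 - 1 / \<alpha>) * (\<Sum>\<^sub>\<infinity>y. \<mu> y * p y powr \<rho>)
       + (1 - 1 / \<rho>) * (\<Sum>\<^sub>\<infinity>y. \<mu> y * h y powr \<alpha>))"
      using hs by (rule infsumI)
    also have "\<dots> \<le> S powr \<beta> * (\<beta> / S * S + (1 - 1 / \<alpha>) * 1 + (1 - 1 / \<rho>) * 1)"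
      using exps S by (intro mult_left_mono add_mono p_sum h_sum) auto
    also have "\<dots> = S powr \<beta>" using S exps(4) by simp
    finally show ?thesis using sm by simp
  qed
  then show "(\<lambda>y. \<mu> y * (p y * h y)) summable_on UNIV"
    and "(\<Sum>\<^sub>\<infinity>y. \<mu> y * (p y * h y)) \<le> (\<Sum>\<^sub>\<infinity>y. \<mu> y * (p y powr \<rho> * h y powr \<alpha>)) powr \<beta>"
    by (auto simp: S_def)
qed

section \<open>Young's inequality for a normalised symmetric kernel\<close>

lemma summable_on_mult_bounded:
  fixes f g :: "'v \<Rightarrow> real"
  assumes "f summable_on UNIV" "\<And>x. 0 \<le> f x" "\<And>x. 0 \<le> g x" "\<And>x. g x \<le> C"
  shows "(\<lambda>x. f x * g x) summable_on UNIV"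
  by (rule summable_on_comparison_test[OF summable_on_cmult_left[OF assms(1), of C]])
    (use assms in \<open>auto intro: mult_left_mono\<close>)

lemma has_sum_finite_sum:
  fixes f :: "'i \<Rightarrow> 'v \<Rightarrow> 'b::topological_comm_monoid_add"
  assumes "\<And>i. i \<in> F \<Longrightarrow> (f i has_sum s i) A"
  shows "((\<lambda>x. \<Sum>i\<in>F. f i x) has_sum (\<Sum>i\<in>F. s i)) A"
  using assms by (induction F rule: infinite_finite_induct) (auto intro: has_sum_add)

text \<open>Row by row the interpolated bound gives \<open>T x \<le> S x powr \<beta>\<close>. For
  \<beta> = 0 this is the sup bound. For \<beta> > 0 it makes \<open>T x powr (1 / \<beta>)\<close>
  at most \<open>S x\<close>, and summing \<open>\<mu> x * S x\<close> over \<open>x\<close> first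
  leaves column sums of the kernel, which symmetry turns into row sums bounded by 1.\<close>

lemma young_kernel_normalised:
  fixes \<mu> h :: "'v \<Rightarrow> real" and p :: "'v \<Rightarrow> 'v \<Rightarrow> real" and \<alpha> \<rho> \<beta> \<epsilon> :: real
  assumes mu: "0 < \<epsilon>" "\<And>y. \<epsilon> \<le> \<mu> y" and p: "\<And>x y. 0 \<le> p x y" "\<And>x y. p x y = p y x"
    and h: "\<And>y. 0 \<le> h y"
    and exps: "1 \<le> \<alpha>" "1 \<le> \<rho>" "0 \<le> \<beta>" "1 / \<alpha> + 1 / \<rho> = 1 + \<beta>"
    and p_sum: "\<And>x. (\<lambda>y. \<mu> y * p x y powr \<rho>) summable_on UNIV"
      "\<And>x. (\<Sum>\<^sub>\<infinity>y. \<mu> y * p x y powr \<rho>) \<le> 1"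
    and h_sum: "(\<lambda>y. \<mu> y * h y powr \<alpha>) summable_on UNIV" "(\<Sum>\<^sub>\<infinity>y. \<mu> y * h y powr \<alpha>) \<le> 1"
  shows "(\<lambda>y. \<mu> y * (p x y * h y)) summable_on UNIV" (is ?th1)
    and "\<beta> = 0 \<Longrightarrow> (\<Sum>\<^sub>\<infinity>y. \<mu> y * (p x y * h y)) \<le> 1" (is "_ \<Longrightarrow> ?th2")
    and "0 < \<beta> \<Longrightarrow> (\<lambda>x. \<mu> x * (\<Sum>\<^sub>\<infinity>y. \<mu> y * (p x y * h y)) powr (1 / \<beta>)) summable_on UNIV" (is "_ \<Longrightarrow> ?th3")
    and "0 < \<beta> \<Longrightarrow> (\<Sum>\<^sub>\<infinity>x. \<mu> x * (\<Sum>\<^sub>\<infinity>y. \<mu> y * (p x y * h y)) powr (1 / \<beta>)) \<le> 1" (is "_ \<Longrightarrow> ?th4")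
proof -
  have mu0: "0 \<le> \<mu> y" for y using mu(1) mu(2)[of y] by linarith
  \<comment> \<open>A single term of a row sum is at most 1, and its measure is at least \<epsilon>.
    This uniform bound on the kernel is what makes the mixed sums converge.\<close>
  have bnd: "p x y powr \<rho> \<le> 1 / \<epsilon>" for x y
  proof -
    have "\<epsilon> * p x y powr \<rho> \<le> \<mu> y * p x y powr \<rho>" using mu by (intro mult_right_mono) auto
    also have "\<dots> \<le> (\<Sum>\<^sub>\<infinity>y. \<mu> y * p x y powr \<rho>)"
      using finite_sum_le_infsum[OF p_sum(1), of "{y}" x] mu0 by simp
    also note p_sum(2)
    finally show ?thesis using mu(1) by (simp add: field_simps)
  qed
  define S where "S x = (\<Sum>\<^sub>\<infinity>y. \<mu> y * (p x y powr \<rho> * h y powr \<alpha>))" for x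
  define T where "T x = (\<Sum>\<^sub>\<infinity>y. \<mu> y * (p x y * h y))" for x
  have S_sum: "(\<lambda>y. \<mu> y * (p x y powr \<rho> * h y powr \<alpha>)) summable_on UNIV" for x
    using summable_on_mult_bounded[OF h_sum(1), of "\<lambda>y. p x y powr \<rho>", OF _ _ bnd] mu0
    by (simp add: mult_ac)
  note H = interpolated_hoelder[OF mu0 p(1) h exps p_sum h_sum S_sum]
  show ?th1 by (rule H(1))
  have T0: "0 \<le> T x" for x unfolding T_def by (intro infsum_nonneg) (simp add: mu0 p h)
  have TS: "T x \<le> S x powr \<beta>" for x using H(2)[of x] unfolding T_def S_def by simp
  have S0: "0 \<le> S x" for x unfolding S_def by (intro infsum_nonneg) (simp add: mu0)
  \<comment> \<open>\<open>S x powr 0\<close> is 1, or 0 when \<open>S x = 0\<close>; both are at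
    most 1.\<close>
  show ?th2 if "\<beta> = 0"
    using TS[of x] that by (simp add: T_def split: if_splits)
  assume "0 < \<beta>"
  \<comment> \<open>Restricting \<open>x\<close> to finite sets makes the exchange of summations a
    finite sum of convergent series, so no Fubini theorem for double series enters.\<close>
  have fin: "(\<Sum>x\<in>F. \<mu> x * T x powr (1 / \<beta>)) \<le> 1" if "finite F" for F
  proof -
    have "(\<Sum>x\<in>F. \<mu> x * T x powr (1 / \<beta>)) \<le> (\<Sum>x\<in>F. \<mu> x * S x)"
    proof (intro sum_mono mult_left_mono mu0)
      fix x
      have "T x powr (1 / \<beta>) \<le> (S x powr \<beta>) powr (1 / \<beta>)"
        using \<open>0 < \<beta>\<close> by (intro powr_mono2 TS T0) auto
      also have "\<dots> = S x" using \<open>0 < \<beta>\<close> S0[of x] by (simp add: powr_powr)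
      finally show "T x powr (1 / \<beta>) \<le> S x" .
    qed
    also have "\<dots> \<le> (\<Sum>\<^sub>\<infinity>y. \<mu> y * h y powr \<alpha>)"
    proof (rule has_sum_mono)
      show "((\<lambda>y. \<Sum>x\<in>F. \<mu> x * (\<mu> y * (p x y powr \<rho> * h y powr \<alpha>))) has_sum (\<Sum>x\<in>F. \<mu> x * S x)) UNIV"
        unfolding S_def using that by (intro has_sum_finite_sum has_sum_cmult_right has_sum_infsum S_sum)
      show "((\<lambda>y. \<mu> y * h y powr \<alpha>) has_sum (\<Sum>\<^sub>\<infinity>y. \<mu> y * h y powr \<alpha>)) UNIV"
        by (intro has_sum_infsum h_sum)
      fix y
      have "(\<Sum>x\<in>F. \<mu> x * p y x powr \<rho>) \<le> (\<Sum>\<^sub>\<infinity>x. \<mu> x * p y x powr \<rho>)"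
        using that by (intro finite_sum_le_infsum p_sum) (auto simp: mu0)
      also note p_sum(2)
      finally have "(\<Sum>x\<in>F. \<mu> x * p x y powr \<rho>) * (\<mu> y * h y powr \<alpha>) \<le> 1 * (\<mu> y * h y powr \<alpha>)"
        using mu0 by (intro mult_right_mono) (auto simp: p(2)[of y])
      then show "(\<Sum>x\<in>F. \<mu> x * (\<mu> y * (p x y powr \<rho> * h y powr \<alpha>))) \<le> \<mu> y * h y powr \<alpha>"
        by (simp add: sum_distrib_right sum_distrib_left mult_ac)
    qed
    also note h_sum(2)
    finally show ?thesis .
  qed
  show ?th3 unfolding T_def[symmetric]
    by (rule nonneg_bdd_above_summable_on) (auto simp: mu0 intro!: bdd_aboveI2[where M=1] fin)
  then show ?th4 unfolding T_def[symmetric]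
    by (rule infsum_le_finite_sums) (auto intro: fin)
qed

section \<open>Normalisation in the sequence spaces and arithmetic of the exponents\<close>

lemma one_le_enn2real:
  assumes "1 \<le> q" "q \<noteq> \<infinity>"
  shows "1 \<le> enn2real q"
  using assms by (cases q) (auto simp flip: ennreal_1 simp del: ennreal_1)

text \<open>The divisor is any positive upper bound of the norm rather than the norm itself, so
  functions of norm 0 need no separate treatment.\<close>

lemma ell_normalise:
  fixes \<mu> f :: "'v \<Rightarrow> real"
  assumes "f \<in> ell_space \<mu> q" "ell_norm \<mu> q f \<le> N" "0 < N" and q: "1 \<le> q" "q \<noteq> \<infinity>"
    and mu: "\<And>x. 0 \<le> \<mu> x"
  shows "(\<lambda>x. \<mu> x * (\<bar>f x\<bar> / N) powr enn2real q) summable_on UNIV"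
    and "(\<Sum>\<^sub>\<infinity>x. \<mu> x * (\<bar>f x\<bar> / N) powr enn2real q) \<le> 1"
proof -
  define Q where "Q = enn2real q"
  have Q: "0 < Q" using one_le_enn2real[OF q] by (simp add: Q_def)
  have eq: "(\<lambda>x. \<mu> x * (\<bar>f x\<bar> / N) powr Q) = (\<lambda>x. \<mu> x * \<bar>f x\<bar> powr Q * inverse (N powr Q))"
    using \<open>0 < N\<close> by (auto simp: powr_divide field_simps)
  have sm: "(\<lambda>x. \<mu> x * \<bar>f x\<bar> powr Q) summable_on UNIV"
    using assms(1) q by (simp add: ell_space_def Q_def)
  have I0: "0 \<le> (\<Sum>\<^sub>\<infinity>x. \<mu> x * \<bar>f x\<bar> powr Q)" by (intro infsum_nonneg) (simp add: mu)
  have "(\<Sum>\<^sub>\<infinity>x. \<mu> x * \<bar>f x\<bar> powr Q) powr (1 / Q) \<le> N"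
    using assms(2) q by (simp add: ell_norm_def Q_def)
  then have "((\<Sum>\<^sub>\<infinity>x. \<mu> x * \<bar>f x\<bar> powr Q) powr (1 / Q)) powr Q \<le> N powr Q"
    using Q by (intro powr_mono2) auto
  then have le: "(\<Sum>\<^sub>\<infinity>x. \<mu> x * \<bar>f x\<bar> powr Q) \<le> N powr Q"
    using Q I0 by (simp add: powr_powr)
  show "(\<lambda>x. \<mu> x * (\<bar>f x\<bar> / N) powr enn2real q) summable_on UNIV"
    unfolding Q_def[symmetric] eq by (intro summable_on_cmult_left sm)
  show "(\<Sum>\<^sub>\<infinity>x. \<mu> x * (\<bar>f x\<bar> / N) powr enn2real q) \<le> 1"
    unfolding Q_def[symmetric] eq infsum_cmult_left' using le \<open>0 < N\<close>
    by (simp add: field_simps)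
qed

lemma ell_normalise_infinity:
  fixes \<mu> f :: "'v \<Rightarrow> real"
  assumes "f \<in> ell_space \<mu> \<infinity>" "ell_norm \<mu> \<infinity> f \<le> N" "0 < N"
  shows "\<bar>f x\<bar> / N \<le> 1"
proof -
  obtain B where "\<bar>f x\<bar> \<le> B" for x
    using assms(1) by (auto simp: ell_space_def bounded_iff)
  then have "\<bar>f x\<bar> \<le> (SUP x. \<bar>f x\<bar>)"
    by (intro cSUP_upper) (auto intro!: bdd_aboveI2[where M=B])
  then show ?thesis using assms(2,3) by (simp add: ell_norm_def field_simps)
qed

text \<open>The way back from normalised quantities: a majorant \<open>u\<close> in the unit ball,
  scaled by \<open>M\<close>, controls the norm. Membership comes with the bound because the
  infinite sum of a non-summable family defaults to 0.\<close>

lemma ell_dominated: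
  fixes \<mu> f u :: "'v \<Rightarrow> real"
  assumes "1 \<le> q" "0 \<le> M" and mu: "\<And>x. 0 \<le> \<mu> x"
    and f: "\<And>x. \<bar>f x\<bar> \<le> M * u x" and u: "\<And>x. 0 \<le> u x"
    and inf: "\<And>x. q = \<infinity> \<Longrightarrow> u x \<le> 1"
    and fin: "q \<noteq> \<infinity> \<Longrightarrow> (\<lambda>x. \<mu> x * u x powr enn2real q) summable_on UNIV"
      "q \<noteq> \<infinity> \<Longrightarrow> (\<Sum>\<^sub>\<infinity>x. \<mu> x * u x powr enn2real q) \<le> 1"
  shows "f \<in> ell_space \<mu> q \<and> ell_norm \<mu> q f \<le> M"
proof (cases "q = \<infinity>")
  case True
  have "\<bar>f x\<bar> \<le> M" for x
    using f[of x] mult_left_mono[OF inf[OF True] \<open>0 \<le> M\<close>, of x] by simp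
  then show ?thesis using True
    by (auto simp: ell_space_def ell_norm_def bounded_iff intro!: cSUP_least)
next
  case False
  define Q where "Q = enn2real q"
  have Q: "0 < Q" using one_le_enn2real[OF assms(1) False] by (simp add: Q_def)
  have sm: "(\<lambda>x. M powr Q * (\<mu> x * u x powr Q)) summable_on UNIV"
    using fin(1)[OF False] unfolding Q_def by (rule summable_on_cmult_right)
  have le: "\<mu> x * \<bar>f x\<bar> powr Q \<le> M powr Q * (\<mu> x * u x powr Q)" for x
  proof -
    have "\<bar>f x\<bar> powr Q \<le> (M * u x) powr Q" using Q f[of x] by (intro powr_mono2) auto
    then show ?thesis using mult_left_mono[OF _ mu[of x]] \<open>0 \<le> M\<close> u
      by (fastforce simp: powr_mult mult_ac)
  qed
  have sf: "(\<lambda>x. \<mu> x * \<bar>f x\<bar> powr Q) summable_on UNIV"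
    by (rule summable_on_comparison_test[OF sm le]) (simp add: mu)
  have "(\<Sum>\<^sub>\<infinity>x. \<mu> x * \<bar>f x\<bar> powr Q) \<le> (\<Sum>\<^sub>\<infinity>x. M powr Q * (\<mu> x * u x powr Q))"
    by (intro infsum_mono sf sm le)
  also have "\<dots> \<le> M powr Q * 1"
    unfolding infsum_cmult_right' using fin(2)[OF False] unfolding Q_def
    by (intro mult_left_mono) auto
  finally have "(\<Sum>\<^sub>\<infinity>x. \<mu> x * \<bar>f x\<bar> powr Q) powr (1 / Q) \<le> (M powr Q) powr (1 / Q)"
    using Q by (intro powr_mono2) (auto intro: infsum_nonneg simp: mu)
  also have "\<dots> = M" using Q \<open>0 \<le> M\<close> by (simp add: powr_powr)
  finally show ?thesis using sf False by (simp add: ell_space_def ell_norm_def Q_def)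
qed

text \<open>The reciprocals are finite even at infinite exponents, so the exponent relation can be
  moved to the reals, where terms cancel. The values 0 and 1 of the reciprocal identify the endpoint
  exponents.\<close>

lemma enn2real_inverse_exponent:
  fixes q :: ennreal
  assumes "1 \<le> q"
  shows "1 / q = ennreal (enn2real (1 / q)) \<and> enn2real (1 / q) \<le> 1 \<and>
    (enn2real (1 / q) = 0 \<longrightarrow> q = \<infinity>) \<and> (enn2real (1 / q) = 1 \<longrightarrow> q = 1) \<and>
    (q = \<infinity> \<longrightarrow> enn2real (1 / q) = 0) \<and> (q \<noteq> \<infinity> \<longrightarrow> enn2real (1 / q) = 1 / enn2real q)"
proof (cases q)
  case (real Q)
  then have Q: "1 \<le> Q" using assms by (simp flip: ennreal_1 del: ennreal_1)
  have "1 / q = ennreal 1 / ennreal Q" using real by simp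
  also have "\<dots> = ennreal (1 / Q)" using Q by (intro divide_ennreal) auto
  finally show ?thesis using Q real by simp
qed simp

text \<open>The real reciprocals lie in [0,1] and satisfy \<open>1 + B = A + R\<close>. If one of
  \<open>A\<close>, \<open>R\<close> is 0, the other must be 1 and \<open>B\<close> must be 0, which
  gives the two endpoint cases. In the remaining case \<open>a\<close> and \<open>r\<close> are
  finite, while \<open>b\<close> may still be infinite.\<close>

lemma young_exponents:
  fixes a b r :: ennreal
  assumes "1 \<le> a" "1 \<le> b" "1 \<le> r" "1 + 1 / b = 1 / a + 1 / r"
  obtains (left) "a = 1" "r = \<infinity>" "b = \<infinity>"
  | (right) "a = \<infinity>" "r = 1" "b = \<infinity>"
  | (finite) "a \<noteq> \<infinity>" "r \<noteq> \<infinity>" "1 \<le> enn2real a" "1 \<le> enn2real r"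
      "1 / enn2real a + 1 / enn2real r = 1 + enn2real (1 / b)"
proof -
  note inv = enn2real_inverse_exponent
  define A B R where "A = enn2real (1 / a)" and "B = enn2real (1 / b)" and "R = enn2real (1 / r)"
  note A = inv[OF assms(1), folded A_def] and B = inv[OF assms(2), folded B_def]
    and R = inv[OF assms(3), folded R_def]
  have nonneg: "0 \<le> A" "0 \<le> B" "0 \<le> R" by (simp_all add: A_def B_def R_def)
  have Ai: "1 / a = ennreal A" and Bi: "1 / b = ennreal B" and Ri: "1 / r = ennreal R"
    using A B R by blast+
  have "ennreal (1 + B) = 1 + 1 / b" unfolding Bi using nonneg(2) by (simp only: ennreal_plus zero_le_one ennreal_1)
  also have "\<dots> = 1 / a + 1 / r" by (rule assms(4))
  also have "\<dots> = ennreal (A + R)" unfolding Ai Ri using nonneg by (simp only: ennreal_plus)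
  finally have eq: "1 + B = A + R" using nonneg by (subst (asm) ennreal_inj) auto
  consider "a = \<infinity>" | "r = \<infinity>" | "a \<noteq> \<infinity>" "r \<noteq> \<infinity>" by blast
  then show thesis
  proof cases
    case 1
    then have "A = 0" using A by blast
    then have "B = 0" "R = 1" using eq nonneg R by linarith+
    then show ?thesis using right 1 B R by blast
  next
    case 2
    then have "R = 0" using R by blast
    then have "B = 0" "A = 1" using eq nonneg A by linarith+
    then show ?thesis using left 2 A B by blast
  next
    case 3
    then have "A = 1 / enn2real a" "R = 1 / enn2real r" using A R by blast+
    then have "1 / enn2real a + 1 / enn2real r = 1 + enn2real (1 / b)"
      using eq unfolding B_def by linarith
    then show ?thesis
      by (rule finite[OF 3 one_le_enn2real[OF assms(1) 3(1)] one_le_enn2real[OF assms(3) 3(2)]])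
  qed
qed

section \<open>Young's inequality for symmetric kernels with general norms\<close>

text \<open>Dividing the kernel by \<open>K\<close> and \<open>g\<close> by \<open>N\<close> reduces
  to the normalised case, and linearity restores the factor \<open>K * N\<close>. At the two
  endpoints one factor is bounded by 1 and the other has sum at most 1.\<close>

lemma young_kernel_scaled:
  fixes \<mu> g :: "'v \<Rightarrow> real" and p :: "'v \<Rightarrow> 'v \<Rightarrow> real" and a b r :: ennreal
  assumes mu: "0 < \<epsilon>" "\<And>y. \<epsilon> \<le> \<mu> y" and p: "\<And>x y. 0 \<le> p x y" "\<And>x y. p x y = p y x"
    and exps: "1 \<le> a" "1 \<le> b" "1 \<le> r" "1 + 1 / b = 1 / a + 1 / r"
    and K: "0 < K" "\<And>x. p x \<in> ell_space \<mu> r" "\<And>x. ell_norm \<mu> r (p x) \<le> K"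
    and N: "0 < N" "g \<in> ell_space \<mu> a" "ell_norm \<mu> a g \<le> N"
  shows "(\<lambda>y. p x y * g y * \<mu> y) summable_on UNIV"
    and "(\<lambda>x. \<Sum>\<^sub>\<infinity>y. p x y * g y * \<mu> y) \<in> ell_space \<mu> b \<and>
      ell_norm \<mu> b (\<lambda>x. \<Sum>\<^sub>\<infinity>y. p x y * g y * \<mu> y) \<le> K * N"
proof -
  have mu0: "0 \<le> \<mu> y" for y using mu(1) mu(2)[of y] by linarith
  \<comment> \<open>The normalised kernel applied to the normalised absolute value of
    \<open>g\<close>; it serves as the majorant in \<open>ell_dominated\<close>.\<close>
  define T where "T x = (\<Sum>\<^sub>\<infinity>y. \<mu> y * (p x y / K * (\<bar>g y\<bar> / N)))" for x
  have T0: "0 \<le> T x" for x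
    unfolding T_def using mu0 p K(1) N(1) by (intro infsum_nonneg) simp
  have "(\<forall>x. (\<lambda>y. \<mu> y * (p x y / K * (\<bar>g y\<bar> / N))) summable_on UNIV) \<and>
      (b = \<infinity> \<longrightarrow> (\<forall>x. T x \<le> 1)) \<and> (b \<noteq> \<infinity> \<longrightarrow>
       (\<lambda>x. \<mu> x * T x powr enn2real b) summable_on UNIV \<and>
       (\<Sum>\<^sub>\<infinity>x. \<mu> x * T x powr enn2real b) \<le> 1)"
    using exps
  proof (cases rule: young_exponents)
    case left
    have g1: "(\<lambda>y. \<mu> y * (\<bar>g y\<bar> / N)) summable_on UNIV" "(\<Sum>\<^sub>\<infinity>y. \<mu> y * (\<bar>g y\<bar> / N)) \<le> 1"
      using ell_normalise[OF N(2,3,1) exps(1) _ mu0] left N(1) by simp_all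
    have p1: "p x y / K \<le> 1" for x y
      using ell_normalise_infinity[OF _ _ K(1), of "p x" \<mu> y] K(2,3)[of x] left p(1)[of x y] by simp
    have le: "\<mu> y * (p x y / K * (\<bar>g y\<bar> / N)) \<le> \<mu> y * (\<bar>g y\<bar> / N)" for x y
      using mult_right_mono[OF p1[of x y], of "\<bar>g y\<bar> / N"] N(1) by (intro mult_left_mono mu0) simp
    have sm: "(\<lambda>y. \<mu> y * (p x y / K * (\<bar>g y\<bar> / N))) summable_on UNIV" for x
      by (rule summable_on_comparison_test[OF g1(1) le]) (use mu0 p K(1) N(1) in simp)
    have "T x \<le> 1" for x
      unfolding T_def by (rule order_trans[OF infsum_mono[OF sm g1(1) le] g1(2)])
    then show ?thesis using sm left by simp
  next
    case right
    have p1: "(\<lambda>y. \<mu> y * (p x y / K)) summable_on UNIV" "(\<Sum>\<^sub>\<infinity>y. \<mu> y * (p x y / K)) \<le> 1" for x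
      using ell_normalise[OF K(2,3,1) exps(3) _ mu0, of x] right K(1) p(1) by simp_all
    have g1: "\<bar>g y\<bar> / N \<le> 1" for y
      using ell_normalise_infinity[OF _ _ N(1), of g \<mu> y] N(2,3) right by simp
    have le: "\<mu> y * (p x y / K * (\<bar>g y\<bar> / N)) \<le> \<mu> y * (p x y / K)" for x y
      using mult_left_mono[OF g1[of y], of "p x y / K"] K(1) p(1)[of x y] by (intro mult_left_mono mu0) simp
    have sm: "(\<lambda>y. \<mu> y * (p x y / K * (\<bar>g y\<bar> / N))) summable_on UNIV" for x
      by (rule summable_on_comparison_test[OF p1(1) le]) (use mu0 p K(1) N(1) in simp)
    have "T x \<le> 1" for x
      unfolding T_def by (rule order_trans[OF infsum_mono[OF sm p1(1) le] p1(2)])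
    then show ?thesis using sm right by simp
  next
    case finite
    have g1: "(\<lambda>y. \<mu> y * (\<bar>g y\<bar> / N) powr enn2real a) summable_on UNIV"
      "(\<Sum>\<^sub>\<infinity>y. \<mu> y * (\<bar>g y\<bar> / N) powr enn2real a) \<le> 1"
      using ell_normalise[OF N(2,3,1) exps(1) _ mu0] finite by simp_all
    have p1: "(\<lambda>y. \<mu> y * (p x y / K) powr enn2real r) summable_on UNIV"
      "(\<Sum>\<^sub>\<infinity>y. \<mu> y * (p x y / K) powr enn2real r) \<le> 1" for x
      using ell_normalise[OF K(2,3,1) exps(3) _ mu0, of x] finite p(1) by simp_all
    have pk: "0 \<le> p x y / K" "p x y / K = p y x / K" for x y using p K(1) by auto
    have gN: "0 \<le> \<bar>g y\<bar> / N" for y using N(1) by simp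
    note Y = young_kernel_normalised[OF mu pk gN finite(3,4) enn2real_nonneg finite(5) p1 g1,
        folded T_def]
    show ?thesis
    proof (cases "b = \<infinity>")
      \<comment> \<open>Here \<open>1 / b\<close> is 0, so the branch \<beta> = 0 supplies the sup
        bound.\<close>
      case True
      then show ?thesis using Y(1,2) by simp
    next
      case False
      then obtain B where B: "1 \<le> B" "b = ennreal B"
        using exps(2) by (cases b) (auto simp flip: ennreal_1 simp del: ennreal_1)
      then have "enn2real (1 / b) = 1 / B"
        by (simp add: divide_ennreal flip: ennreal_1)
      then show ?thesis using Y(1,3,4) B False by simp
    qed
  qed
  then have sm: "(\<lambda>y. \<mu> y * (p x y / K * (\<bar>g y\<bar> / N))) summable_on UNIV"
    and T_inf: "b = \<infinity> \<Longrightarrow> T x \<le> 1"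
    and T_fin: "b \<noteq> \<infinity> \<Longrightarrow> (\<lambda>x. \<mu> x * T x powr enn2real b) summable_on UNIV"
       "b \<noteq> \<infinity> \<Longrightarrow> (\<Sum>\<^sub>\<infinity>x. \<mu> x * T x powr enn2real b) \<le> 1" for x
    by auto
  have eq: "norm (p x y * g y * \<mu> y) = K * N * (\<mu> y * (p x y / K * (\<bar>g y\<bar> / N)))" for x y
    using K(1) N(1) p(1) mu0 by (simp add: abs_mult)
  have abs: "(\<lambda>y. norm (p x y * g y * \<mu> y)) summable_on UNIV" for x
    unfolding eq by (intro summable_on_cmult_right sm)
  then show "(\<lambda>y. p x y * g y * \<mu> y) summable_on UNIV"
    by (rule abs_summable_summable)
  have "\<bar>\<Sum>\<^sub>\<infinity>y. p x y * g y * \<mu> y\<bar> \<le> K * N * T x" for x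
    using norm_infsum_bound[OF abs] unfolding eq infsum_cmult_right' T_def by simp
  then show "(\<lambda>x. \<Sum>\<^sub>\<infinity>y. p x y * g y * \<mu> y) \<in> ell_space \<mu> b \<and>
      ell_norm \<mu> b (\<lambda>x. \<Sum>\<^sub>\<infinity>y. p x y * g y * \<mu> y) \<le> K * N"
    using K(1) N(1) by (intro ell_dominated[where u = T] exps mu0 T0 T_inf T_fin) auto
qed

lemma ell_norm_nonneg:
  assumes "f \<in> ell_space \<mu> q"
  shows "0 \<le> ell_norm \<mu> q f"
proof (cases "q = \<infinity>")
  case True
  then obtain B where "\<bar>f x\<bar> \<le> B" for x
    using assms by (auto simp: ell_space_def bounded_iff)
  \<comment> \<open>\<open>undefined\<close> stands for an arbitrary vertex: one value of the
    absolute value already bounds the supremum from below by 0.\<close>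
  then have "\<bar>f undefined\<bar> \<le> (SUP x. \<bar>f x\<bar>)"
    by (intro cSUP_upper) (auto intro!: bdd_aboveI2[where M=B])
  then show ?thesis using True by (simp add: ell_norm_def)
qed (simp add: ell_norm_def)

text \<open>The scaled version applies to every \<open>N\<close> strictly above the norm of
  \<open>g\<close>, hence to positive \<open>N\<close> only. Letting \<open>N\<close> decrease to
  the norm covers the norm 0 as well.\<close>

lemma young_kernel:
  fixes \<mu> g :: "'v \<Rightarrow> real" and p :: "'v \<Rightarrow> 'v \<Rightarrow> real" and a b r :: ennreal
  assumes mu: "0 < \<epsilon>" "\<And>y. \<epsilon> \<le> \<mu> y" and p: "\<And>x y. 0 \<le> p x y" "\<And>x y. p x y = p y x"
    and exps: "1 \<le> a" "1 \<le> b" "1 \<le> r" "1 + 1 / b = 1 / a + 1 / r"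
    and K: "0 < K" "\<And>x. p x \<in> ell_space \<mu> r" "\<And>x. ell_norm \<mu> r (p x) \<le> K"
    and g: "g \<in> ell_space \<mu> a"
  shows "(\<lambda>y. p x y * g y * \<mu> y) summable_on UNIV" (is ?th1)
    and "(\<lambda>x. \<Sum>\<^sub>\<infinity>y. p x y * g y * \<mu> y) \<in> ell_space \<mu> b" (is ?th2)
    and "ell_norm \<mu> b (\<lambda>x. \<Sum>\<^sub>\<infinity>y. p x y * g y * \<mu> y) \<le> K * ell_norm \<mu> a g" (is "?n \<le> _")
proof -
  have Y: "?th1 \<and> ?th2 \<and> ?n \<le> K * N" if N: "ell_norm \<mu> a g < N" for N
  proof -
    have "0 < N" using ell_norm_nonneg[OF g] N by linarith
    note S = young_kernel_scaled[OF mu p exps K this g less_imp_le[OF N]]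
    show ?thesis using S(1)[of x] S(2) by blast
  qed
  have "ell_norm \<mu> a g < ell_norm \<mu> a g + 1" by linarith
  note Y[OF this]
  then show ?th1 ?th2 by blast+
  have "?n / K \<le> ell_norm \<mu> a g"
  proof (rule dense_ge)
    fix N assume "ell_norm \<mu> a g < N"
    from Y[OF this] have "?n \<le> N * K" by (simp only: mult.commute)
    then show "?n / K \<le> N" using K(1) by (simp only: pos_divide_le_eq)
  qed
  then show "?n \<le> K * ell_norm \<mu> a g"
    using K(1) by (simp only: pos_divide_le_eq mult.commute)
qed

section \<open>Symmetry and total mass of the heat kernel\<close>

text \<open>The heat equation is required in both variables and the initial value is symmetric, so
  the transpose is again a fundamental solution. Minimality, used for both orders of the vertices,
  gives equality.\<close>

lemma heat_kernel_symmetric: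
  assumes P: "is_heat_kernel \<omega> \<mu> P" and "0 \<le> t"
  shows "P t x y = P t y x"
proof -
  have "heat_fundamental_solution \<omega> \<mu> (\<lambda>t x y. P t y x)"
    using P unfolding is_heat_kernel_def heat_fundamental_solution_def by metis
  then have "P t x y \<le> P t y x" for x y
    using P \<open>0 \<le> t\<close> unfolding is_heat_kernel_def by blast
  then show ?thesis by (simp add: order_antisym)
qed

lemma laplacian_lower_bound:
  assumes G: "weighted_graph \<omega> \<mu>" and u: "\<And>z. 0 \<le> u z"
    and D: "1 / \<mu> y * (\<Sum>z | adj \<omega> y z. \<omega> y z) \<le> D"
  shows "- D * u y \<le> laplacian \<omega> \<mu> u y"
proof -
  have pos: "0 < \<mu> y" and w: "0 \<le> \<omega> y z" for z
    using G by (auto simp: weighted_graph_def)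
  have "laplacian \<omega> \<mu> u y =
      1 / \<mu> y * (\<Sum>z | adj \<omega> y z. \<omega> y z * u z) - 1 / \<mu> y * (\<Sum>z | adj \<omega> y z. \<omega> y z) * u y"
    by (simp add: laplacian_def right_diff_distrib sum_subtractf sum_distrib_right diff_divide_distrib)
  moreover have "0 \<le> 1 / \<mu> y * (\<Sum>z | adj \<omega> y z. \<omega> y z * u z)"
    using pos w u by (intro mult_nonneg_nonneg sum_nonneg) auto
  moreover have "1 / \<mu> y * (\<Sum>z | adj \<omega> y z. \<omega> y z) * u y \<le> D * u y"
    by (intro mult_right_mono D u)
  ultimately show ?thesis by linarith
qed

text \<open>Edges inside \<open>F\<close> cancel, so only the inflow through the boundary of \<open>F\<close> remains.\<close>

lemma sum_laplacian_le_inflow: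
  assumes G: "weighted_graph \<omega> \<mu>"
    and D: "\<And>y. 1 / \<mu> y * (\<Sum>z | adj \<omega> y z. \<omega> y z) \<le> D"
    and "finite F"
  obtains B where "finite B" "F \<inter> B = {}"
    "\<And>u. (\<And>z. 0 \<le> u z) \<Longrightarrow> (\<Sum>y\<in>F. \<mu> y * laplacian \<omega> \<mu> u y) \<le> D * (\<Sum>z\<in>B. \<mu> z * u z)"
proof
  have pos: "0 < \<mu> y" and w: "0 \<le> \<omega> y z" and sym: "\<omega> y z = \<omega> z y"
    and fin: "finite {z. adj \<omega> y z}" for y z
    using G by (auto simp: weighted_graph_def)
  \<comment> \<open>The outer vertex boundary of \<open>F\<close>: together with \<open>F\<close> it
    contains all neighbours of points of \<open>F\<close>.\<close>
  let ?B = "(\<Union>y\<in>F. {z. adj \<omega> y z}) - F"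
  show fB: "finite ?B" "F \<inter> ?B = {}" using \<open>finite F\<close> fin by auto
  fix u :: "'a \<Rightarrow> real" assume u: "\<And>z. 0 \<le> u z"
  have row: "\<mu> y * laplacian \<omega> \<mu> u y =
      (\<Sum>z\<in>F. \<omega> y z * (u z - u y)) + (\<Sum>z\<in>?B. \<omega> y z * (u z - u y))" if "y \<in> F" for y
  proof -
    have "\<mu> y * laplacian \<omega> \<mu> u y = (\<Sum>z | adj \<omega> y z. \<omega> y z * (u z - u y))"
      using pos[of y] by (simp add: laplacian_def)
    also have "\<dots> = (\<Sum>z\<in>F \<union> ?B. \<omega> y z * (u z - u y))"
      using that \<open>finite F\<close> fB w[of y]
      by (intro sum.mono_neutral_left) (auto simp: adj_def not_less intro: antisym)
    also have "\<dots> = (\<Sum>z\<in>F. \<omega> y z * (u z - u y)) + (\<Sum>z\<in>?B. \<omega> y z * (u z - u y))"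
      by (intro sum.union_disjoint \<open>finite F\<close> fB)
    finally show ?thesis .
  qed
  \<comment> \<open>The summand is antisymmetric in \<open>y\<close> and \<open>z\<close>, so the
    double sum equals its own negative.\<close>
  have "(\<Sum>y\<in>F. \<Sum>z\<in>F. \<omega> y z * (u z - u y)) = (\<Sum>z\<in>F. \<Sum>y\<in>F. \<omega> y z * (u z - u y))"
    by (rule sum.swap)
  also have "\<dots> = - (\<Sum>y\<in>F. \<Sum>z\<in>F. \<omega> y z * (u z - u y))"
    unfolding sum_negf[symmetric] by (intro sum.cong refl) (simp add: sym algebra_simps)
  finally have inner: "(\<Sum>y\<in>F. \<Sum>z\<in>F. \<omega> y z * (u z - u y)) = 0" by simp
  have "(\<Sum>y\<in>F. \<mu> y * laplacian \<omega> \<mu> u y) = (\<Sum>y\<in>F. \<Sum>z\<in>?B. \<omega> y z * (u z - u y))"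
    using inner by (simp add: row sum.distrib)
  also have "\<dots> \<le> (\<Sum>y\<in>F. \<Sum>z\<in>?B. \<omega> y z * u z)"
    using w u by (intro sum_mono mult_left_mono) auto
  \<comment> \<open>Symmetry of \<omega> lets the weight between \<open>z\<close> and
    \<open>F\<close> be read as part of the degree of \<open>z\<close>, to which the bound
    \<open>D\<close> applies.\<close>
  also have "\<dots> = (\<Sum>z\<in>?B. (\<Sum>y\<in>F. \<omega> z y) * u z)"
    by (subst sum.swap) (simp add: sum_distrib_right sym)
  also have "\<dots> \<le> (\<Sum>z\<in>?B. D * \<mu> z * u z)"
  proof (intro sum_mono mult_right_mono u)
    fix z
    have "(\<Sum>y\<in>F. \<omega> z y) = (\<Sum>y\<in>F \<inter> {y. adj \<omega> z y}. \<omega> z y)"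
      using \<open>finite F\<close> w[of z] by (intro sum.mono_neutral_right) (auto simp: adj_def not_less intro: antisym)
    also have "\<dots> \<le> (\<Sum>y | adj \<omega> z y. \<omega> z y)"
      using fin w by (intro sum_mono2) auto
    also have "\<dots> \<le> D * \<mu> z" using D[of z] pos[of z] by (simp add: field_simps)
    finally show "(\<Sum>y\<in>F. \<omega> z y) \<le> D * \<mu> z" .
  qed
  finally show "(\<Sum>y\<in>F. \<mu> y * laplacian \<omega> \<mu> u y) \<le> D * (\<Sum>z\<in>?B. \<mu> z * u z)"
    by (simp add: sum_distrib_left mult_ac)
qed

text \<open>
  The growth of \<open>exp (D * s) * P s x y\<close> in \<open>s\<close> makes the tails of the mass at time \<open>t\<close> dominate
  those at all earlier times, so the inflow into a large finite set is uniformly small.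
\<close>

lemma heat_kernel_mass_le_1:
  assumes G: "weighted_graph \<omega> \<mu>" and P: "heat_fundamental_solution \<omega> \<mu> P" and "0 < t"
    and D: "\<And>y. 1 / \<mu> y * (\<Sum>z | adj \<omega> y z. \<omega> y z) \<le> D"
    and sm: "(\<lambda>y. \<mu> y * P t x y) summable_on UNIV"
  shows "(\<Sum>\<^sub>\<infinity>y. \<mu> y * P t x y) \<le> 1"
proof -
  have pos: "0 < \<mu> y" and w: "0 \<le> \<omega> y z" for y z
    using G by (auto simp: weighted_graph_def)
  have P0: "0 \<le> P s x y" if "0 \<le> s" for s y
    using P that by (auto simp: heat_fundamental_solution_def)
  have dP: "((\<lambda>s. P s x y) has_real_derivative laplacian \<omega> \<mu> (P s x) y) (at s)" if "0 < s" for s y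
    using P that by (auto simp: heat_fundamental_solution_def)
  have init: "((\<lambda>s. P s x y) \<longlongrightarrow> P 0 x y) (at_right 0)" for y
    using P unfolding heat_fundamental_solution_def by blast
  have P_0: "P 0 x y = (if x = y then 1 / \<mu> y else 0)" for y
    using P unfolding heat_fundamental_solution_def by blast
  have "0 \<le> 1 / \<mu> x * (\<Sum>z | adj \<omega> x z. \<omega> x z)"
    using pos[of x] w by (intro mult_nonneg_nonneg sum_nonneg) auto
  then have D0: "0 \<le> D" using D[of x] by linarith
  have grow: "P s x y \<le> exp (D * t) * P t x y" if "0 < s" "s \<le> t" for s y
  proof -
    have "exp (D * s) * P s x y \<le> exp (D * t) * P t x y"
    proof (rule DERIV_nonneg_imp_nondecreasing[OF \<open>s \<le> t\<close>])
      fix q assume q: "s \<le> q" "q \<le> t"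
      have "((\<lambda>q. exp (D * q) * P q x y) has_real_derivative
          exp (D * q) * (D * P q x y + laplacian \<omega> \<mu> (P q x) y)) (at q)"
        using q that by (auto intro!: derivative_eq_intros dP simp: algebra_simps)
      moreover have "0 \<le> exp (D * q) * (D * P q x y + laplacian \<omega> \<mu> (P q x) y)"
      proof -
        have "- D * P q x y \<le> laplacian \<omega> \<mu> (P q x) y"
          using q that by (intro laplacian_lower_bound[OF G _ D] P0) simp
        then show ?thesis by simp
      qed
      ultimately show "\<exists>z. ((\<lambda>q. exp (D * q) * P q x y) has_real_derivative z) (at q) \<and> 0 \<le> z"
        by blast
    qed
    moreover have "1 * P s x y \<le> exp (D * s) * P s x y"
      using D0 that by (intro mult_right_mono P0) auto
    ultimately show ?thesis by linarith
  qed
  define M where "M = (\<Sum>\<^sub>\<infinity>y. \<mu> y * P t x y)"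
  \<comment> \<open>The factor \<open>D\<close> comes from the inflow bound,
    \<open>exp (D * t)\<close> from comparing earlier times with time \<open>t\<close>.\<close>
  define C where "C = D * exp (D * t)"
  have C0: "0 \<le> C" using D0 by (simp add: C_def)
  \<comment> \<open>Of the error, one \<epsilon> is the mass outside \<open>F\<close> at time
    \<open>t\<close>, and \<open>C * t * \<epsilon>\<close> is the inflow into \<open>F\<close> up
    to time \<open>t\<close>.\<close>
  have le: "M \<le> 1 + (C * t + 1) * \<epsilon>" if eps: "0 < \<epsilon>" for \<epsilon>
  proof -
    obtain F where F: "finite F" "dist (\<Sum>y\<in>F. \<mu> y * P t x y) M \<le> \<epsilon>"
      using infsum_finite_approximation[OF sm eps] unfolding M_def by blast
    obtain B where B: "finite B" "F \<inter> B = {}"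
      and flow: "\<And>u. (\<And>z. 0 \<le> u z) \<Longrightarrow> (\<Sum>y\<in>F. \<mu> y * laplacian \<omega> \<mu> u y) \<le> D * (\<Sum>z\<in>B. \<mu> z * u z)"
      using sum_laplacian_le_inflow[OF G D F(1)] by blast
    define m where "m s = (\<Sum>y\<in>F. \<mu> y * P s x y)" for s
    \<comment> \<open>\<open>B\<close> is disjoint from \<open>F\<close>, so its mass is part of
      what \<open>F\<close> misses.\<close>
    have "m t + (\<Sum>z\<in>B. \<mu> z * P t x z) = (\<Sum>z\<in>F \<union> B. \<mu> z * P t x z)"
      unfolding m_def using F B by (intro sum.union_disjoint[symmetric])
    also have "\<dots> \<le> M" unfolding M_def
      using F B P0[of t] pos \<open>0 < t\<close>
      by (intro finite_sum_le_infsum sm mult_nonneg_nonneg) (simp_all add: less_imp_le)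
    finally have tail: "(\<Sum>z\<in>B. \<mu> z * P t x z) \<le> \<epsilon>"
      using F(2) by (simp add: m_def dist_real_def)
    have slow: "m t - C * \<epsilon> * t \<le> m s - C * \<epsilon> * s" if s: "0 < s" "s \<le> t" for s
    proof (rule DERIV_nonpos_imp_nonincreasing[OF \<open>s \<le> t\<close>])
      fix q assume q: "s \<le> q" "q \<le> t"
      have "((\<lambda>q. m q - C * \<epsilon> * q) has_real_derivative
          (\<Sum>y\<in>F. \<mu> y * laplacian \<omega> \<mu> (P q x) y) - C * \<epsilon>) (at q)"
        unfolding m_def using q s by (auto intro!: derivative_eq_intros dP simp: mult.commute)
      moreover have "(\<Sum>y\<in>F. \<mu> y * laplacian \<omega> \<mu> (P q x) y) - C * \<epsilon> \<le> 0"
      proof -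
        have "(\<Sum>y\<in>F. \<mu> y * laplacian \<omega> \<mu> (P q x) y) \<le> D * (\<Sum>z\<in>B. \<mu> z * P q x z)"
          using q s by (intro flow P0) auto
        also have "\<dots> \<le> D * (\<Sum>z\<in>B. \<mu> z * (exp (D * t) * P t x z))"
          using q s pos by (intro mult_left_mono[OF _ D0] sum_mono mult_left_mono grow)
            (auto intro: less_imp_le)
        also have "\<dots> = C * (\<Sum>z\<in>B. \<mu> z * P t x z)"
          by (simp add: C_def sum_distrib_left mult_ac)
        also have "\<dots> \<le> C * \<epsilon>" by (intro mult_left_mono tail C0)
        finally show ?thesis by simp
      qed
      ultimately show "\<exists>z. ((\<lambda>q. m q - C * \<epsilon> * q) has_real_derivative z) (at q) \<and> z \<le> 0"
        by blast
    qed
    \<comment> \<open>The differential equation holds only for positive times, so time 0 is reached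
      by right-continuity.\<close>
    have lim: "((\<lambda>s. m s - C * \<epsilon> * s) \<longlongrightarrow> m 0 - C * \<epsilon> * 0)
        (at_right 0)"
      unfolding m_def by (intro tendsto_intros init)
    have "\<forall>\<^sub>F s in at_right 0. m t - C * \<epsilon> * t \<le> m s - C * \<epsilon> * s"
      unfolding eventually_at_right_field using slow \<open>0 < t\<close> by (intro exI[of _ t]) simp
    then have "m t - C * \<epsilon> * t \<le> m 0 - C * \<epsilon> * 0"
      by (intro tendsto_lowerbound[OF lim]) auto
    also have "m 0 = (\<Sum>y\<in>F. if x = y then 1 else 0)"
      unfolding m_def P_0
    proof (intro sum.cong refl)
      show "\<mu> y * (if x = y then 1 / \<mu> y else 0) = (if x = y then 1 else 0)" for y
        using pos[of y] by simp
    qed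
    also have "\<dots> \<le> (1 :: real)" using F(1) by simp
    finally show ?thesis using F(2) by (simp add: m_def dist_real_def algebra_simps)
  qed
  \<comment> \<open>The error factor depends on \<open>t\<close> and \<open>D\<close> but not on
    \<epsilon>, so it is absorbed by rescaling.\<close>
  have "M \<le> 1 + \<epsilon>" if "0 < \<epsilon>" for \<epsilon>
  proof -
    have "0 < C * t + 1" using C0 \<open>0 < t\<close> by (simp add: add_nonneg_pos)
    then show ?thesis using le[of "\<epsilon> / (C * t + 1)"] that by simp
  qed
  then show ?thesis unfolding M_def[symmetric] by (rule field_le_epsilon)
qed

section \<open>The estimate for the heat semigroup\<close>

theorem theorem2p2:
  fixes \<omega> :: "'v \<Rightarrow> 'v \<Rightarrow> real" and \<mu> :: "'v \<Rightarrow> real"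
    and P :: "real \<Rightarrow> 'v \<Rightarrow> 'v \<Rightarrow> real"
    and n c3 m C4 :: real and a b r :: ennreal
  assumes "weighted_graph \<omega> \<mu>"
    and "is_heat_kernel \<omega> \<mu> P"
    and "0 < mu_min \<mu>" and "mu_max \<mu> < \<infinity>" and "0 < omega_min \<omega>" and "D_mu \<omega> \<mu> < \<infinity>"
    and "0 < n" and "CDE \<omega> \<mu> n 0"
    and "0 < c3" and "0 < m" and "\<And>x R. 0 < R \<Longrightarrow> volume \<omega> \<mu> x R \<ge> c3 * R powr m"
    and "1 \<le> a" and "1 \<le> b" and "1 \<le> r" and "1 + 1 / b = 1 / a + 1 / r"
    and "0 < C4"
    and "\<And>x t. 0 < t \<Longrightarrow> P t x \<in> ell_space \<mu> r \<and>
           ell_norm \<mu> r (P t x) \<le> C4 * t powr (- (m / 2) * (1 - enn2real (1 / r)))"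
  shows "\<forall>g \<in> ell_space \<mu> a. \<forall>t>0.
           (\<forall>x. (\<lambda>y. P t x y * g y * \<mu> y) summable_on UNIV) \<and>
           (\<lambda>x. \<Sum>\<^sub>\<infinity>y. P t x y * g y * \<mu> y) \<in> ell_space \<mu> b \<and>
           ell_norm \<mu> b (\<lambda>x. \<Sum>\<^sub>\<infinity>y. P t x y * g y * \<mu> y)
             \<le> (if b = 1 then 1 else C4) * ell_norm \<mu> a g
                * t powr (- (m / 2) * (1 - enn2real (1 / r)))"
proof -
  note G = assms(1)
  have P: "heat_fundamental_solution \<omega> \<mu> P" using assms(2) by (simp add: is_heat_kernel_def)
  have P0: "0 \<le> P t x y" if "0 < t" for t x y
    using P that by (auto simp: heat_fundamental_solution_def)
  note sym = heat_kernel_symmetric[OF assms(2)]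
  obtain \<epsilon> where "0 < ereal \<epsilon>" "ereal \<epsilon> < mu_min \<mu>"
    using ereal_dense2[OF assms(3)] by auto
  moreover have "mu_min \<mu> \<le> ereal (\<mu> y)" for y
    unfolding mu_min_def by (rule INF_lower) simp
  ultimately have mu: "0 < \<epsilon>" "\<epsilon> \<le> \<mu> y" for y
    by (simp, metis ereal_less_eq(3) less_imp_le order_trans)
  obtain D where "D_mu \<omega> \<mu> < ereal D" using ereal_dense2[OF assms(6)] by auto
  moreover have "ereal (1 / \<mu> y * (\<Sum>z | adj \<omega> y z. \<omega> y z)) \<le> D_mu \<omega> \<mu>" for y
    unfolding D_mu_def by (rule SUP_upper) simp
  ultimately have D: "1 / \<mu> y * (\<Sum>z | adj \<omega> y z. \<omega> y z) \<le> D" for y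
    by (metis ereal_less_eq(3) less_imp_le order_trans)
  show ?thesis
  proof (intro ballI allI impI)
    fix g t assume g: "g \<in> ell_space \<mu> a" and t: "(0::real) < t"
    define e where "e = t powr (- (m / 2) * (1 - enn2real (1 / r)))"
    \<comment> \<open>The bound for the rows of the kernel at time \<open>t\<close>. For
      \<open>b = 1\<close> it equals 1, because then \<open>r = 1\<close> and the power of
      \<open>t\<close> has exponent 0.\<close>
    define K where "K = (if b = 1 then 1 else C4) * e"
    have K: "0 < K" using assms(16) t by (simp add: K_def e_def)
    have Pr: "P t x \<in> ell_space \<mu> r" for x using assms(17)[OF t] by blast
    have norm: "ell_norm \<mu> r (P t x) \<le> K" for x
    proof (cases "b = 1")
      case True
      have ar: "r = 1"
        using assms(12-15) True
      proof (cases rule: young_exponents)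
        \<comment> \<open>The other two cases have \<open>b = \<infinity>\<close>. Here two
          reciprocals, each at most 1, add up to 2.\<close>
        case finite
        then have "1 / enn2real a \<le> 1" "1 / enn2real r \<le> 1" by simp_all
        moreover have "1 / enn2real a + 1 / enn2real r = 2" using finite True by simp
        ultimately have "1 / enn2real r = 1" by linarith
        then have "enn2real r = 1" using finite by simp
        then show ?thesis using finite by (metis ennreal_enn2real_if ennreal_1 infinity_ennreal_def)
      qed simp_all
      have sm: "(\<lambda>y. \<mu> y * P t x y) summable_on UNIV"
        using Pr[of x] P0[OF t] ar by (simp add: ell_space_def)
      \<comment> \<open>Nonnegativity makes the outer \<open>powr 1\<close> in
        \<open>ell_norm\<close> the identity.\<close>
      have "0 \<le> (\<Sum>\<^sub>\<infinity>y. \<mu> y * P t x y)"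
        using P0[OF t] mu by (intro infsum_nonneg mult_nonneg_nonneg) (auto intro: order_trans less_imp_le)
      then show ?thesis
        using heat_kernel_mass_le_1[OF G P t D sm] P0[OF t] ar True t
        by (simp add: ell_norm_def K_def e_def)
    next
      case False
      then show ?thesis using assms(17)[OF t] by (simp add: K_def e_def)
    qed
    note Y = young_kernel[OF mu P0[OF t] sym[OF less_imp_le[OF t]] assms(12-15) K Pr norm g]
    show "(\<forall>x. (\<lambda>y. P t x y * g y * \<mu> y) summable_on UNIV) \<and>
        (\<lambda>x. \<Sum>\<^sub>\<infinity>y. P t x y * g y * \<mu> y) \<in> ell_space \<mu> b \<and>
        ell_norm \<mu> b (\<lambda>x. \<Sum>\<^sub>\<infinity>y. P t x y * g y * \<mu> y)
          \<le> (if b = 1 then 1 else C4) * ell_norm \<mu> a g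
             * t powr (- (m / 2) * (1 - enn2real (1 / r)))"
      using Y unfolding K_def e_def by (simp add: mult_ac)
  qed
qed

end
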